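(* Let $D=\mathbb{Z}[\omega]$ with $\omega=\frac{-1+i\sqrt{3}}{2}$, and let $\pi\in D$ be a primary prime with $N\pi\neq 3$. If $\pi=q$ is a rational prime, write $q=3m-1$ with $m\in\mathbb{Z}$; if $\pi=a+b\omega$ is a (non-rational) primary prime with $a,b\in\mathbb{Z}$, write $a=3m-1$ with $m\in\mathbb{Z}$. Then $$\chi_\pi(1-\omega)=\omega^{2m}.$$
   Context: For $\alpha=a+b\omega\in D$ with $a,b\in\mathbb{Z}$, the norm is $N\alpha=\alpha\overline{\alpha}=a^2-ab+b^2$. A prime $\pi\in D$ is called primary if $\pi\equiv 2\pmod 3$ in $D$ (i.e. $\pi=a+b\omega$ with $a\equiv 2$, $b\equiv 0\pmod 3$). A rational prime is a prime of $\mathbb{Z}$. For a prime $\pi\in D$ with $N\pi\ne 3$, the cubic residue character $\chi_\pi$ on $D$ is defined by: $\chi_\pi(\alpha)=0$ if $\pi\mid\alpha$; otherwise $\chi_\pi(\alpha)$ is the unique element of $\{1,\omega,\omega^2\}$ with $\alpha^{(N\pi-1)/3}\equiv\chi_\pi(\alpha)\pmod{\pi}$. *)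

theory Defs
  imports Complex_Main "HOL-Computational_Algebra.Primes"
begin

definition complex_omega :: complex where
  "complex_omega = (-1 + \<i> * complex_of_real (sqrt 3)) / 2"

lemma complex_omega_square: "complex_omega * complex_omega = -1 - complex_omega"
  by (simp add: complex_omega_def complex_eq_iff field_simps)

lemma complex_omega_cnj: "cnj complex_omega = -1 - complex_omega"
  by (simp add: complex_omega_def complex_eq_iff field_simps)

typedef eisenstein = "{z :: complex. \<exists>a b :: int. z = of_int a + of_int b * complex_omega}"
  morphisms complex_of_eis eis_of_complex
  by blast

setup_lifting type_definition_eisenstein

instantiation eisenstein :: idom
begin

lift_definition zero_eisenstein :: eisenstein is 0
  by (rule exI[of _ 0], rule exI[of _ 0]) simp

lift_definition one_eisenstein :: eisenstein is 1
  by (rule exI[of _ 1], rule exI[of _ 0]) simp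

lift_definition plus_eisenstein :: "eisenstein \<Rightarrow> eisenstein \<Rightarrow> eisenstein" is "(+)"
proof clarify
  fix a b c d :: int
  show "\<exists>e f :: int. of_int a + of_int b * complex_omega + (of_int c + of_int d * complex_omega)
          = of_int e + of_int f * complex_omega"
    by (rule exI[of _ "a + c"], rule exI[of _ "b + d"]) (simp add: algebra_simps)
qed

lift_definition uminus_eisenstein :: "eisenstein \<Rightarrow> eisenstein" is "uminus"
proof clarify
  fix a b :: int
  show "\<exists>e f :: int. - (of_int a + of_int b * complex_omega) = of_int e + of_int f * complex_omega"
    by (rule exI[of _ "- a"], rule exI[of _ "- b"]) (simp add: algebra_simps)
qed

lift_definition minus_eisenstein :: "eisenstein \<Rightarrow> eisenstein \<Rightarrow> eisenstein" is "(-)"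
proof clarify
  fix a b c d :: int
  show "\<exists>e f :: int. of_int a + of_int b * complex_omega - (of_int c + of_int d * complex_omega)
          = of_int e + of_int f * complex_omega"
    by (rule exI[of _ "a - c"], rule exI[of _ "b - d"]) (simp add: algebra_simps)
qed

lift_definition times_eisenstein :: "eisenstein \<Rightarrow> eisenstein \<Rightarrow> eisenstein" is "(*)"
proof clarify
  fix a b c d :: int
  have "(of_int a + of_int b * complex_omega) * (of_int c + of_int d * complex_omega)
      = of_int a * of_int c + (of_int a * of_int d + of_int b * of_int c) * complex_omega
        + of_int b * of_int d * (complex_omega * complex_omega)"
    by (simp add: algebra_simps)
  also have "\<dots> = of_int (a * c - b * d) + of_int (a * d + b * c - b * d) * complex_omega"
    by (simp add: complex_omega_square algebra_simps)
  finally show "\<exists>e f :: int. (of_int a + of_int b * complex_omega) * (of_int c + of_int d * complex_omega)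
          = of_int e + of_int f * complex_omega"
    by blast
qed

instance
  by standard (transfer; simp add: algebra_simps)+

end

lift_definition eis_omega :: eisenstein is complex_omega
  by (rule exI[of _ 0], rule exI[of _ 1]) simp

lift_definition eis_cnj :: "eisenstein \<Rightarrow> eisenstein" is cnj
proof clarify
  fix a b :: int
  show "\<exists>e f :: int. cnj (of_int a + of_int b * complex_omega) = of_int e + of_int f * complex_omega"
    by (rule exI[of _ "a - b"], rule exI[of _ "- b"]) (simp add: complex_omega_cnj algebra_simps)
qed

lemma complex_of_eis_of_nat: "complex_of_eis (of_nat n) = of_nat n"
  by (induction n) (simp_all add: zero_eisenstein.rep_eq one_eisenstein.rep_eq plus_eisenstein.rep_eq)

lemma complex_of_eis_of_int: "complex_of_eis (of_int k) = of_int k"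
  by (cases k) (simp_all add: complex_of_eis_of_nat one_eisenstein.rep_eq plus_eisenstein.rep_eq
      uminus_eisenstein.rep_eq minus_eisenstein.rep_eq)

lemma complex_of_eis_eq:
  "complex_of_eis (of_int a + of_int b * eis_omega) = of_int a + of_int b * complex_omega"
  by (simp add: plus_eisenstein.rep_eq times_eisenstein.rep_eq complex_of_eis_of_int eis_omega.rep_eq)

lemma eisenstein_cases:
  obtains a b :: int where "\<alpha> = of_int a + of_int b * eis_omega"
proof -
  obtain a b :: int where "complex_of_eis \<alpha> = of_int a + of_int b * complex_omega"
    using complex_of_eis[of \<alpha>] by blast
  then have "\<alpha> = of_int a + of_int b * eis_omega"
    by (simp add: complex_of_eis_inject[symmetric] complex_of_eis_eq)
  then show thesis by (rule that)
qed

lemma eisenstein_eq_iff: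
  "(of_int a + of_int b * eis_omega = of_int c + of_int d * eis_omega) \<longleftrightarrow> a = c \<and> b = d"
proof
  assume "of_int a + of_int b * eis_omega = of_int c + of_int d * eis_omega"
  then have eq: "of_int a + of_int b * complex_omega = of_int c + of_int d * complex_omega"
    by (metis complex_of_eis_eq)
  have "b = d"
    using arg_cong[OF eq, of Im] by (simp add: complex_omega_def)
  with eq show "a = c \<and> b = d" by simp
qed simp

definition eis_norm :: "eisenstein \<Rightarrow> int" where
  "eis_norm \<alpha> = (THE n. of_int n = \<alpha> * eis_cnj \<alpha>)"

lemma eis_norm_eq: "eis_norm (of_int a + of_int b * eis_omega) = a^2 - a * b + b^2"
proof -
  let ?\<alpha> = "of_int a + of_int b * eis_omega"
  have "complex_of_eis (?\<alpha> * eis_cnj ?\<alpha>)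
      = (of_int a + of_int b * complex_omega) * (of_int a + of_int b * (-1 - complex_omega))"
    by (simp add: times_eisenstein.rep_eq eis_cnj.rep_eq complex_of_eis_eq complex_omega_cnj)
  also have "\<dots> = of_int (a^2) - of_int (a * b) - of_int (b^2) * complex_omega
        - of_int (b^2) * (complex_omega * complex_omega)"
    by (simp add: algebra_simps power2_eq_square)
  also have "\<dots> = complex_of_eis (of_int (a^2 - a * b + b^2))"
    unfolding complex_of_eis_of_int by (simp add: complex_omega_square algebra_simps)
  finally have *: "of_int (a^2 - a * b + b^2) = ?\<alpha> * eis_cnj ?\<alpha>"
    by (simp only: complex_of_eis_inject)
  have inj: "n = k" if "(of_int n :: eisenstein) = of_int k" for n k
    using that eisenstein_eq_iff[of n 0 k 0] by simp
  show ?thesis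
    unfolding eis_norm_def by (rule the_equality) (use * in \<open>auto intro: inj\<close>)
qed

definition eis_cong :: "eisenstein \<Rightarrow> eisenstein \<Rightarrow> eisenstein \<Rightarrow> bool" where
  "eis_cong \<mu> \<alpha> \<beta> \<longleftrightarrow> \<mu> dvd (\<alpha> - \<beta>)"

definition eis_primary :: "eisenstein \<Rightarrow> bool" where
  "eis_primary \<pi> \<longleftrightarrow> eis_cong 3 \<pi> 2"

lemma eis_primary_iff:
  "eis_primary (of_int a + of_int b * eis_omega) \<longleftrightarrow> a mod 3 = 2 \<and> b mod 3 = 0"
proof
  assume "eis_primary (of_int a + of_int b * eis_omega)"
  then obtain \<gamma> where \<gamma>: "of_int a + of_int b * eis_omega - 2 = 3 * \<gamma>"
    unfolding eis_primary_def eis_cong_def by (auto elim: dvdE)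
  obtain c d where "\<gamma> = of_int c + of_int d * eis_omega"
    by (rule eisenstein_cases)
  with \<gamma> have "of_int a + of_int b * eis_omega = of_int (3 * c + 2) + of_int (3 * d) * eis_omega"
    by (simp add: algebra_simps)
  then show "a mod 3 = 2 \<and> b mod 3 = 0"
    unfolding eisenstein_eq_iff by (simp add: mod_simps)
next
  assume ab: "a mod 3 = 2 \<and> b mod 3 = 0"
  have "a = 3 * (a div 3) + 2" "b = 3 * (b div 3)"
    using ab by presburger+
  then obtain c d where "a = 3 * c + 2" "b = 3 * d"
    by blast
  then have "of_int a + of_int b * eis_omega - 2 = 3 * (of_int c + of_int d * eis_omega)"
    by (simp add: algebra_simps)
  then show "eis_primary (of_int a + of_int b * eis_omega)"
    unfolding eis_primary_def eis_cong_def by (metis dvd_triv_left)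
qed

text \<open>Meaningful only for a prime \<open>\<pi>\<close> with norm different from 3. Then either \<open>\<pi>\<close> divides \<open>\<alpha>\<close>, or
  the residue in question exists and is unique; moreover the norm is 1 modulo 3, so that
  the division in the exponent is exact.\<close>

definition cubic_char :: "eisenstein \<Rightarrow> eisenstein \<Rightarrow> eisenstein" where
  "cubic_char \<pi> \<alpha> =
     (if \<pi> dvd \<alpha> then 0
      else (THE z. z \<in> {1, eis_omega, eis_omega^2} \<and>
                   eis_cong \<pi> (\<alpha> ^ nat ((eis_norm \<pi> - 1) div 3)) z))"

end

theory Submission
  imports Defs "HOL-Computational_Algebra.Polynomial"
begin

text \<open>
  All sums run over a residue system of \<open>D / \<pi>\<close>, a field with \<open>N = 3 k + 1\<close> elements, so rational
  and non-rational \<open>\<pi>\<close> are treated alike. The polynomial \<open>X^k - \<omega>\<close> splits modulo \<open>\<pi>\<close> with roots the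
  \<open>x\<close> of character \<open>\<omega>\<close>; evaluating it at 1 gives \<open>1 - \<omega> \<equiv> \<Prod> (1 - x)\<close>, so \<open>\<chi> (1 - \<omega>)\<close> is
  \<open>\<omega>\<close> to the power \<open>n(1,1) + 2 n(1,2)\<close>, where \<open>n(i,j)\<close> counts the \<open>x\<close> with \<open>\<chi> x = \<omega>^i\<close> and
  \<open>\<chi> (1 - x) = \<omega>^j\<close>. The symmetries \<open>x \<mapsto> 1 - x\<close> and \<open>x \<mapsto> 1/x\<close> express the Jacobi sum
  \<open>J = \<Sum> \<chi> x \<chi> (1 - x)\<close> through these counts: its rational coordinate is
  \<open>3 (n(1,2) - n(1,1)) - 1\<close> and its other coordinate is divisible by 3. As \<open>J\<close> is thus primary,
  divisible by \<open>\<pi>\<close> and of norm \<open>N\<close>, it equals \<open>\<pi>\<close>. Hence \<open>m = n(1,2) - n(1,1)\<close>, and modulo 3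
  the exponent is \<open>2 m\<close>.
\<close>

section \<open>Finite residue fields of an integral domain\<close>

text \<open>The residue field is handled through a finite set of representatives, not as a quotient
  type; congruence stays divisibility in the ring.\<close>

locale finite_residue_field =
  fixes p :: "'a::idom" and R :: "'a set"
  assumes prime: "prime_elem p"
    and finite_R: "finite R"
    and ex1_rep: "\<exists>!x. x \<in> R \<and> p dvd z - x"
begin

definition rep :: "'a \<Rightarrow> 'a" where
  "rep z = (THE x. x \<in> R \<and> p dvd z - x)"

lemma rep_in [simp]: "rep z \<in> R" and dvd_minus_rep: "p dvd z - rep z"
  using theI'[OF ex1_rep[of z]] by (auto simp: rep_def)

lemma cong_sym: "p dvd x - y \<Longrightarrow> p dvd y - x"
  by (metis dvd_minus_iff minus_diff_eq)

lemma cong_trans: "p dvd x - y \<Longrightarrow> p dvd y - z \<Longrightarrow> p dvd x - z"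
  by (metis diff_add_cancel dvd_add add_diff_eq)

lemma cong_mult: "p dvd x - y \<Longrightarrow> p dvd u - v \<Longrightarrow> p dvd x * u - y * v"
proof -
  assume "p dvd x - y" "p dvd u - v"
  moreover have "x * u - y * v = (x - y) * u + y * (u - v)"
    by (simp add: algebra_simps)
  ultimately show ?thesis by simp
qed

lemma cong_power: "p dvd x - y \<Longrightarrow> p dvd x ^ n - y ^ n"
  by (induction n) (auto intro: cong_mult)

lemma cong_prod: "(\<And>x. x \<in> S \<Longrightarrow> p dvd f x - g x) \<Longrightarrow> p dvd prod f S - prod g S"
  by (induction S rule: infinite_finite_induct) (auto intro: cong_mult)

lemma cong_sum: "(\<And>x. x \<in> S \<Longrightarrow> p dvd f x - g x) \<Longrightarrow> p dvd sum f S - sum g S"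
  by (simp add: sum_subtractf[symmetric] dvd_sum)

lemma cong_R_eq: "x \<in> R \<Longrightarrow> y \<in> R \<Longrightarrow> p dvd x - y \<Longrightarrow> x = y"
  using ex1_rep[of x] by auto

lemma not_dvd_1: "\<not> p dvd 1"
  using prime by (simp add: prime_elem_def)

lemma dvd_mult_iff: "p dvd x * y \<longleftrightarrow> p dvd x \<or> p dvd y"
  using prime by (rule prime_elem_dvd_mult_iff)

section \<open>Changes of variable over the residue system\<close>

lemma bij_betw_rep:
  assumes "\<And>x y. p dvd h x - h y \<Longrightarrow> p dvd x - y"
  shows "bij_betw (\<lambda>x. rep (h x)) R R"
proof -
  have "inj_on (\<lambda>x. rep (h x)) R"
  proof (rule inj_onI)
    fix x y assume xy: "x \<in> R" "y \<in> R" "rep (h x) = rep (h y)"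
    then have "p dvd h x - h y"
      by (metis cong_sym cong_trans dvd_minus_rep)
    then show "x = y" using xy assms cong_R_eq by blast
  qed
  then show ?thesis
    using finite_R by (simp add: bij_betw_def endo_inj_surj image_subset_iff)
qed

text \<open>A substitution that keeps incongruent elements incongruent hits every class once, as
  there are finitely many. The summand must depend on the class only, since \<open>h x\<close> need
  not lie in \<open>R\<close>.\<close>

lemma sum_reindex:
  assumes "\<And>x y. p dvd h x - h y \<Longrightarrow> p dvd x - y"
    and "\<And>x y. p dvd x - y \<Longrightarrow> f x = f y"
  shows "(\<Sum>x\<in>R. f (h x)) = (\<Sum>x\<in>R. f x)"
proof -
  have "(\<Sum>x\<in>R. f (h x)) = (\<Sum>x\<in>R. f (rep (h x)))"
    using assms(2) dvd_minus_rep by (intro sum.cong) auto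
  also have "\<dots> = (\<Sum>x\<in>R. f x)"
    using bij_betw_rep[OF assms(1)] by (rule sum.reindex_bij_betw)
  finally show ?thesis .
qed

lemma cong_sum_reindex:
  assumes "\<And>x y. p dvd h x - h y \<Longrightarrow> p dvd x - y"
    and "\<And>x y. p dvd x - y \<Longrightarrow> p dvd f x - f y"
  shows "p dvd (\<Sum>x\<in>R. f (h x)) - (\<Sum>x\<in>R. f x)"
proof -
  have "(\<Sum>x\<in>R. f (rep (h x))) = (\<Sum>x\<in>R. f x)"
    using bij_betw_rep[OF assms(1)] by (rule sum.reindex_bij_betw)
  then show ?thesis
    using cong_sum[of R "\<lambda>x. f (h x)" "\<lambda>x. f (rep (h x))"] assms(2) dvd_minus_rep by auto
qed

lemma card_reindex:
  assumes "\<And>x y. p dvd h x - h y \<Longrightarrow> p dvd x - y"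
    and "\<And>x y. p dvd x - y \<Longrightarrow> P x \<longleftrightarrow> P y"
  shows "card {x \<in> R. P (h x)} = card {x \<in> R. P x}"
proof -
  have "(\<Sum>x\<in>R. of_bool (P (h x)) :: nat) = (\<Sum>x\<in>R. of_bool (P x))"
  proof -
    have "(\<Sum>x\<in>R. of_bool (P (h x)) :: nat) = (\<Sum>x\<in>R. of_bool (P (rep (h x))))"
      using assms(2) dvd_minus_rep by (intro sum.cong) auto
    also have "\<dots> = (\<Sum>x\<in>R. of_bool (P x))"
      using bij_betw_rep[OF assms(1)] by (rule sum.reindex_bij_betw)
    finally show ?thesis .
  qed
  then show ?thesis
    using finite_R by (simp add: Int_def)
qed

lemma cong_mult_cancel: "\<not> p dvd c \<Longrightarrow> p dvd c * x - c * y \<Longrightarrow> p dvd x - y"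
  by (metis dvd_mult_iff right_diff_distrib)

section \<open>Fermat, roots of polynomials, power sums and inverses\<close>

lemma R_nonzero: "{x \<in> R. \<not> p dvd x} = R - {rep 0}"
proof -
  have "p dvd x \<longleftrightarrow> x = rep 0" if "x \<in> R" for x
    using dvd_minus_rep[of 0] cong_R_eq[OF that rep_in, of 0]
    by auto
  then show ?thesis by auto
qed

lemma card_R_nonzero: "card {x \<in> R. \<not> p dvd x} = card R - 1"
  unfolding R_nonzero using finite_R by simp

text \<open>Multiplication by \<open>c\<close> permutes the nonzero classes; comparing their product
  before and after leaves the factor \<open>c ^ (card R - 1)\<close>.\<close>

lemma fermat:
  assumes "\<not> p dvd c"
  shows "p dvd c ^ (card R - 1) - 1"
proof -
  let ?S = "{x \<in> R. \<not> p dvd x}"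
  have "bij_betw (\<lambda>x. rep (c * x)) R R"
    using assms by (intro bij_betw_rep) (auto dest: cong_mult_cancel)
  then have inj: "inj_on (\<lambda>x. rep (c * x)) ?S"
    by (auto simp: bij_betw_def inj_on_def)
  have "p dvd x" if "p dvd rep (c * x)" for x
    using dvd_minus_rep[of "c * x"] that assms
    by (metis dvd_add diff_add_cancel dvd_mult_iff)
  then have bij: "bij_betw (\<lambda>x. rep (c * x)) ?S ?S"
    using inj finite_R by (intro bij_betw_imageI endo_inj_surj) auto
  let ?P = "\<Prod>x\<in>?S. x"
  have "p dvd (\<Prod>x\<in>?S. c * x) - (\<Prod>x\<in>?S. rep (c * x))"
    by (intro cong_prod dvd_minus_rep)
  also have "(\<Prod>x\<in>?S. rep (c * x)) = ?P"
    using bij by (rule prod.reindex_bij_betw)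
  also have "(\<Prod>x\<in>?S. c * x) = c ^ (card R - 1) * ?P"
    by (simp add: prod.distrib card_R_nonzero)
  also have "c ^ (card R - 1) * ?P - ?P = ?P * (c ^ (card R - 1) - 1)"
    by (simp add: algebra_simps)
  finally have "p dvd ?P \<or> p dvd c ^ (card R - 1) - 1"
    by (simp add: dvd_mult_iff)
  moreover have "\<not> p dvd ?P"
  proof -
    have "\<not> p dvd (\<Prod>x\<in>T. x)" if "T \<subseteq> ?S" for T
      using that not_dvd_1 by (induction T rule: infinite_finite_induct) (auto simp: dvd_mult_iff)
    then show ?thesis by blast
  qed
  ultimately show ?thesis by blast
qed

text \<open>A polynomial over a field with more roots than its degree is zero, which here means that
  \<open>p\<close> divides all coefficients. Each induction step splits off one root.\<close>

lemma lagrange: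
  assumes "S \<subseteq> R" "degree f < card S" "\<And>x. x \<in> S \<Longrightarrow> p dvd poly f x"
  shows "[:p:] dvd f"
proof -
  have "finite S" using assms(1) finite_R finite_subset by blast
  then show ?thesis using assms
  proof (induction S arbitrary: f rule: finite_induct)
    case empty
    then show ?case by simp
  next
    case (insert x S)
    define g where "g = synthetic_div f x"
    have f: "f = [:poly f x:] + [:- x, 1:] * g"
      using synthetic_div_correct'[of x f] by (simp add: g_def add.commute)
    have px: "p dvd poly f x" using insert.prems by simp
    have "p dvd poly g y" if "y \<in> S" for y
    proof -
      have "poly f y = poly f x + (y - x) * poly g y"
        by (subst f) (simp add: algebra_simps)
      moreover have "p dvd poly f y" using that insert.prems by simp
      ultimately have "p dvd (y - x) * poly g y"
        using px by (metis dvd_add_right_iff)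
      moreover have "\<not> p dvd y - x"
        using that insert.hyps insert.prems(1) cong_R_eq[of y x] by auto
      ultimately show ?thesis by (simp add: dvd_mult_iff)
    qed
    \<comment> \<open>A constant \<open>f\<close> is set apart: there \<open>g\<close> is 0, and its
      degree 0 is not below \<open>card S\<close> when \<open>S\<close> is empty.\<close>
    moreover have "degree g < card S \<or> f = [:poly f x:]"
    proof (cases "degree f = 0")
      case True
      then show ?thesis by (auto elim!: degree_eq_zeroE)
    next
      case False
      then show ?thesis
        using insert.prems(2) insert.hyps by (auto simp: g_def degree_synthetic_div)
    qed
    moreover have "[:p:] dvd [:poly f x:]"
      using px by (simp add: const_poly_dvd_const_poly_iff)
    ultimately show ?case
      using insert.IH[of g] insert.prems(1) f by (metis dvd_add dvd_mult insert_subset)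
  qed
qed

lemma const_dvd_imp_dvd_poly: "[:p:] dvd f \<Longrightarrow> p dvd poly f x"
  by (auto elim!: dvdE)

text \<open>\<open>X^n - c\<close> is monic, so it cannot vanish modulo \<open>p\<close>, and
  \<open>lagrange\<close> applies.\<close>

lemma card_roots_le:
  assumes "0 < n"
  shows "card {x \<in> R. p dvd x ^ n - c} \<le> n"
proof (rule ccontr)
  let ?S = "{x \<in> R. p dvd x ^ n - c}"
  let ?f = "monom 1 n - [:c:]"
  assume "\<not> card ?S \<le> n"
  moreover have "degree ?f \<le> n"
    by (intro degree_diff_le) (auto simp: degree_monom_eq)
  ultimately have "[:p:] dvd ?f"
    by (intro lagrange[of ?S]) (auto simp: poly_monom)
  then have "p dvd coeff ?f n" by (simp only: const_poly_dvd_iff)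
  moreover have "coeff ?f n = 1" using assms by (cases n) auto
  ultimately show False using not_dvd_1 by simp
qed

text \<open>Replacing \<open>x\<close> by \<open>c x\<close> multiplies the sum by
  \<open>c ^ j\<close>, so it vanishes modulo \<open>p\<close> once some nonzero \<open>c\<close>
  has \<open>c ^ j\<close> incongruent to 1.\<close>

lemma dvd_sum_power:
  assumes "j < card R - 1"
  shows "p dvd (\<Sum>x\<in>R. x ^ j)"
proof (cases "j = 0")
  case True
  \<comment> \<open>For \<open>j = 0\<close> the sum is the number of classes; shifting by 1
    permutes them and adds exactly this number to the sum of all \<open>x\<close>.\<close>
  have "p dvd (\<Sum>x\<in>R. x + 1) - (\<Sum>x\<in>R. x)"
    by (rule cong_sum_reindex[of "\<lambda>x. x + 1" "\<lambda>x. x"]) simp_all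
  then show ?thesis by (simp add: True sum.distrib)
next
  case False
  \<comment> \<open>Otherwise all \<open>card R - 1\<close> nonzero representatives would be roots
    of \<open>X^j - 1\<close>, more than its degree.\<close>
  have "\<exists>c. \<not> p dvd c \<and> \<not> p dvd c ^ j - 1"
  proof (rule ccontr)
    assume "\<nexists>c. \<not> p dvd c \<and> \<not> p dvd c ^ j - 1"
    then have "card {x \<in> R. \<not> p dvd x} \<le> card {x \<in> R. p dvd x ^ j - 1}"
      using finite_R by (intro card_mono) auto
    then show False
      using card_roots_le[of j 1] False assms by (simp add: card_R_nonzero)
  qed
  then obtain c where c: "\<not> p dvd c" "\<not> p dvd c ^ j - 1" by blast
  have "p dvd (\<Sum>x\<in>R. (c * x) ^ j) - (\<Sum>x\<in>R. x ^ j)"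
    using c by (intro cong_sum_reindex[of "\<lambda>x. c * x" "\<lambda>x. x ^ j"])
      (auto dest: cong_mult_cancel intro: cong_power)
  also have "\<dots> = (c ^ j - 1) * (\<Sum>x\<in>R. x ^ j)"
    by (simp add: power_mult_distrib sum_distrib_left left_diff_distrib sum_subtractf)
  finally show ?thesis using c by (simp add: dvd_mult_iff)
qed

lemma dvd_sum_poly:
  assumes "degree f < card R - 1"
  shows "p dvd (\<Sum>x\<in>R. poly f x)"
proof -
  have "(\<Sum>x\<in>R. poly f x) = (\<Sum>i\<le>degree f. coeff f i * (\<Sum>x\<in>R. x ^ i))"
    unfolding poly_altdef sum_distrib_left by (rule sum.swap)
  then show ?thesis
    using assms by (auto intro!: dvd_sum dvd_mult dvd_sum_power)
qed

text \<open>By Fermat this power inverts nonzero classes. For \<open>card R > 2\<close> it also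
  fixes the zero class, so it can serve as a substitution on all of \<open>R\<close>.\<close>

definition cong_inverse :: "'a \<Rightarrow> 'a" where
  "cong_inverse x = x ^ (card R - 2)"

lemma cong_mult_inverse:
  assumes "\<not> p dvd x" "2 < card R"
  shows "p dvd x * cong_inverse x - 1"
proof -
  have "x * cong_inverse x = x ^ (card R - 1)"
    using assms(2) unfolding cong_inverse_def power_Suc[symmetric]
    by (intro arg_cong[where f = "power x"]) simp
  then show ?thesis using fermat[OF assms(1)] by simp
qed

lemma dvd_cong_inverse_iff:
  assumes "2 < card R"
  shows "p dvd cong_inverse x \<longleftrightarrow> p dvd x"
proof -
  have "p dvd x ^ n \<longleftrightarrow> p dvd x" if "n > 0" for n
    using that prime by (metis dvd_power dvd_trans prime_elem_dvd_power)
  then show ?thesis using assms by (simp add: cong_inverse_def)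
qed

lemma cong_inverse_inj:
  assumes "p dvd cong_inverse x - cong_inverse y" "2 < card R"
  shows "p dvd x - y"
proof (cases "p dvd x")
  case True
  then have "p dvd cong_inverse y"
    using assms dvd_cong_inverse_iff[of x] by (metis cong_sym diff_add_cancel dvd_add)
  then show ?thesis using True assms(2) by (simp add: dvd_cong_inverse_iff)
next
  case False
  then have "\<not> p dvd cong_inverse y"
    using assms dvd_cong_inverse_iff[of x] by (metis diff_add_cancel dvd_add)
  then have y: "\<not> p dvd y" using assms(2) by (simp add: dvd_cong_inverse_iff)
  have "x - y = y * (x * cong_inverse x - 1) - x * (y * cong_inverse y - 1)
      - x * y * (cong_inverse x - cong_inverse y)"
    by (simp add: algebra_simps)
  then show ?thesis
    using assms(1) cong_mult_inverse[OF False assms(2)] cong_mult_inverse[OF y assms(2)]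
    by (metis dvd_diff dvd_mult)
qed

text \<open>Completes a sum over nonzero residues to one over all residues, at the price of the
  value at 0.\<close>

lemma sum_split_zero:
  fixes f :: "'a \<Rightarrow> 'b::comm_ring_1"
  assumes "\<And>x y. p dvd x - y \<Longrightarrow> f x = f y"
  shows "(\<Sum>x\<in>R. f x) = f 0 + (\<Sum>x\<in>R. of_bool (\<not> p dvd x) * f x)"
proof -
  have "(\<Sum>x\<in>R. of_bool (\<not> p dvd x) * f x) = (\<Sum>x\<in>{x \<in> R. \<not> p dvd x}. f x)"
    using finite_R by (intro sum.mono_neutral_cong_right) auto
  then show ?thesis
    using finite_R assms[OF dvd_minus_rep[of 0]] by (simp add: R_nonzero sum.remove[of R "rep 0"])
qed

end

section \<open>Residue systems of Eisenstein integers\<close>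

lemma eis_norm_cnj: "of_int (eis_norm \<alpha>) = \<alpha> * eis_cnj \<alpha>"
proof -
  obtain a b where \<alpha>: "\<alpha> = of_int a + of_int b * eis_omega"
    by (rule eisenstein_cases)
  have "complex_of_eis (of_int (eis_norm \<alpha>)) = complex_of_eis (\<alpha> * eis_cnj \<alpha>)"
    unfolding \<alpha> eis_norm_eq complex_of_eis_of_int times_eisenstein.rep_eq eis_cnj.rep_eq complex_of_eis_eq
    using complex_omega_square by (simp add: complex_omega_cnj, algebra)
  then show ?thesis by (simp only: complex_of_eis_inject)
qed

lemma of_int_eisenstein_eq_iff: "(of_int m :: eisenstein) = of_int n \<longleftrightarrow> m = n"
  using eisenstein_eq_iff[of m 0 n 0] by simp

lemma eis_cnj_mult: "eis_cnj (\<alpha> * \<beta>) = eis_cnj \<alpha> * eis_cnj \<beta>"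
  by transfer simp

lemma eis_norm_mult: "eis_norm (\<alpha> * \<beta>) = eis_norm \<alpha> * eis_norm \<beta>"
proof -
  have "(of_int (eis_norm (\<alpha> * \<beta>)) :: eisenstein) = of_int (eis_norm \<alpha> * eis_norm \<beta>)"
    by (simp add: eis_norm_cnj eis_cnj_mult mult_ac)
  then show ?thesis by (simp only: of_int_eisenstein_eq_iff)
qed

text \<open>Completing the square; this gives positive definiteness and later bounds the coordinates
  of elements of norm 1.\<close>

lemma four_eis_norm:
  "4 * eis_norm (of_int a + of_int b * eis_omega) = (2 * a - b)\<^sup>2 + 3 * b\<^sup>2"
  unfolding eis_norm_eq by (simp add: power2_eq_square algebra_simps)

lemma eis_norm_nonneg: "eis_norm \<alpha> \<ge> 0"
proof -
  obtain a b where "\<alpha> = of_int a + of_int b * eis_omega" by (rule eisenstein_cases)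
  then have "4 * eis_norm \<alpha> = (2 * a - b)\<^sup>2 + 3 * b\<^sup>2" using four_eis_norm by simp
  moreover have "(2 * a - b)\<^sup>2 \<ge> 0" "b\<^sup>2 \<ge> 0" by simp_all
  ultimately show ?thesis by linarith
qed

lemma eis_norm_eq_0_iff: "eis_norm \<alpha> = 0 \<longleftrightarrow> \<alpha> = 0"
proof
  assume *: "eis_norm \<alpha> = 0"
  obtain a b where \<alpha>: "\<alpha> = of_int a + of_int b * eis_omega" by (rule eisenstein_cases)
  then have "(2 * a - b)\<^sup>2 + 3 * b\<^sup>2 = 0" using four_eis_norm[of a b] * by simp
  moreover have "(2 * a - b)\<^sup>2 \<ge> 0" "b\<^sup>2 \<ge> 0" by simp_all
  ultimately have "(2 * a - b)\<^sup>2 = 0" "b\<^sup>2 = 0" by linarith+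
  then show "\<alpha> = 0" by (simp add: \<alpha>)
next
  show "\<alpha> = 0 \<Longrightarrow> eis_norm \<alpha> = 0" using eis_norm_eq[of 0 0] by simp
qed

lemma eis_omega_square: "eis_omega * eis_omega = - 1 - eis_omega"
  by transfer (rule complex_omega_square)

lemma eis_mult_coords:
  "(of_int a + of_int b * eis_omega) * (of_int c + of_int d * eis_omega) =
     of_int (a * c - b * d) + of_int (a * d + b * c - b * d) * eis_omega"
proof -
  have "(of_int a + of_int b * eis_omega) * (of_int c + of_int d * eis_omega) =
     of_int (a * c) + of_int (a * d + b * c) * eis_omega + of_int (b * d) * (eis_omega * eis_omega)"
    by (simp add: algebra_simps)
  then show ?thesis by (simp add: eis_omega_square algebra_simps)
qed

lemma of_int_dvd_eis_iff:
  "of_int n dvd of_int a + of_int b * eis_omega \<longleftrightarrow> n dvd a \<and> n dvd b"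
proof
  assume "of_int n dvd of_int a + of_int b * eis_omega"
  then obtain \<gamma> where \<gamma>: "of_int a + of_int b * eis_omega = of_int n * \<gamma>" by (elim dvdE)
  obtain c d where "\<gamma> = of_int c + of_int d * eis_omega" by (rule eisenstein_cases)
  then have "of_int a + of_int b * eis_omega = of_int (n * c) + of_int (n * d) * eis_omega"
    using \<gamma> by (simp add: algebra_simps)
  then show "n dvd a \<and> n dvd b" unfolding eisenstein_eq_iff by simp
qed (auto elim!: dvdE simp: mult.assoc intro!: dvd_add)

text \<open>The lattice of multiples of \<open>g (a + b \<omega>)\<close> with \<open>a\<close>, \<open>b\<close> coprime has
  the Hermite normal form with rows \<open>(g N, 0)\<close> and \<open>(r, g)\<close>, where
  \<open>N\<close> is the norm of \<open>a + b \<omega>\<close>.\<close>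

lemma ex_eis_residue_system:
  assumes "\<alpha> \<noteq> 0"
  shows "\<exists>R. finite R \<and> int (card R) = eis_norm \<alpha> \<and> (\<forall>z. \<exists>!x. x \<in> R \<and> \<alpha> dvd z - x)"
proof -
  obtain a0 b0 where \<alpha>0: "\<alpha> = of_int a0 + of_int b0 * eis_omega" by (rule eisenstein_cases)
  define g where "g = gcd a0 b0"
  have "a0 \<noteq> 0 \<or> b0 \<noteq> 0" using assms \<alpha>0 by auto
  then have g: "g > 0" by (simp add: g_def)
  obtain a b where ab: "a0 = a * g" "b0 = b * g" "coprime a b"
    using gcd_coprime_exists[of a0 b0] g unfolding g_def by (metis less_irrefl)
  define \<beta> where "\<beta> = of_int a + of_int b * eis_omega"
  define N where "N = eis_norm \<beta>"
  have \<alpha>: "\<alpha> = of_int g * \<beta>" by (simp add: \<alpha>0 ab \<beta>_def algebra_simps)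
  have N: "N > 0"
    using assms eis_norm_nonneg[of \<beta>] eis_norm_eq_0_iff[of \<beta>] by (auto simp: N_def \<alpha>)
  have norm: "eis_norm \<alpha> = g * g * N"
    using eis_norm_eq[of g 0] by (simp add: \<alpha> eis_norm_mult N_def power2_eq_square)
  \<comment> \<open>So \<open>g * N\<close> is a multiple of \<open>\<alpha>\<close>, and rational
    parts may be reduced modulo \<open>g * N\<close>.\<close>
  have \<alpha>_cnj: "\<alpha> * eis_cnj \<beta> = of_int (g * N)"
    by (simp add: \<alpha> N_def eis_norm_cnj mult_ac)
  have cnj: "eis_cnj \<beta> = of_int (a - b) + of_int (- b) * eis_omega"
    unfolding \<beta>_def complex_of_eis_inject[symmetric] complex_of_eis_eq eis_cnj.rep_eq
    by (simp add: complex_omega_cnj algebra_simps)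
  have coprime: "coprime (a - b) b"
    using ab(3) by (metis coprime_iff_gcd_eq_1 gcd_diff1)
  define f where "f = (\<lambda>(x, y). of_int x + of_int y * eis_omega)"
  define R where "R = f ` ({0..<g * N} \<times> {0..<g})"
  have inj: "inj_on f A" for A
    by (auto simp: f_def inj_on_def eisenstein_eq_iff)
  have "int (card R) = eis_norm \<alpha>"
    unfolding R_def card_image[OF inj] using g N by (simp add: norm card_cartesian_product)
  moreover have "finite R" by (simp add: R_def)
  moreover have "\<exists>x. x \<in> R \<and> \<alpha> dvd z - x" for z
  proof -
    obtain u v where z: "z = of_int u + of_int v * eis_omega" by (rule eisenstein_cases)
    \<comment> \<open>Multiplying \<open>\<beta>\<close> by \<open>t + s \<omega>\<close> with these
      Bezout coefficients gives an element with \<open>\<omega>\<close>-coordinate 1.\<close>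
    obtain s t where st: "s * (a - b) + t * b = 1"
      using coprime bezout_int[of "a - b" b] by (auto simp: coprime_iff_gcd_eq_1)
    define q where "q = v div g"
    define w where "w = u - g * (a * (q * t) - b * (q * s))"
    let ?\<gamma> = "of_int (q * t) + of_int (q * s) * eis_omega"
    have "a * (q * s) + b * (q * t) - b * (q * s) = q * (s * (a - b) + t * b)"
      by (simp add: algebra_simps)
    then have \<gamma>: "\<beta> * ?\<gamma> = of_int (a * (q * t) - b * (q * s)) + of_int q * eis_omega"
      unfolding \<beta>_def eis_mult_coords st by simp
    define r where "r = v mod g"
    have v: "v = g * q + r" by (simp add: q_def r_def)
    have "z - \<alpha> * ?\<gamma> = of_int w + of_int r * eis_omega"
      unfolding \<alpha> z w_def mult.assoc \<gamma> unfolding v by (simp add: algebra_simps)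
    moreover have "of_int w = of_int (w mod (g * N)) + \<alpha> * (eis_cnj \<beta> * of_int (w div (g * N)))"
      unfolding mult.assoc[symmetric] \<alpha>_cnj by (simp flip: of_int_mult of_int_add)
    ultimately have "z - f (w mod (g * N), r)
        = \<alpha> * (?\<gamma> + eis_cnj \<beta> * of_int (w div (g * N)))"
      unfolding f_def by (simp add: algebra_simps)
    moreover have "f (w mod (g * N), r) \<in> R"
      unfolding R_def r_def using g N by (intro imageI) auto
    ultimately show ?thesis by (metis dvd_triv_left)
  qed
  moreover have "x = x'" if x: "x \<in> R" "x' \<in> R" "\<alpha> dvd z - x" "\<alpha> dvd z - x'" for x x' z
  proof -
    obtain r s r' s' where rs: "x = f (r, s)" "x' = f (r', s')"
      "r \<in> {0..<g * N}" "r' \<in> {0..<g * N}" "s \<in> {0..<g}" "s' \<in> {0..<g}"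
      using x by (auto simp: R_def)
    have "\<alpha> dvd (z - x') - (z - x)" using x(4,3) by (rule dvd_diff)
    then have dvd: "\<alpha> dvd of_int (r - r') + of_int (s - s') * eis_omega"
      by (simp add: rs f_def algebra_simps)
    then have "of_int g dvd of_int (r - r') + of_int (s - s') * eis_omega"
      unfolding \<alpha> by (rule dvd_mult_left)
    then have "g dvd s - s'" by (simp only: of_int_dvd_eis_iff)
    then have s: "s = s'"
      using rs zdvd_imp_le[of g "s - s'"] zdvd_imp_le[of g "s' - s"]
      by (cases s s' rule: linorder_cases) (auto simp: dvd_diff_commute)
    \<comment> \<open>The conjugate turns \<open>\<alpha>\<close> into an integer, whose
      divisibility can be read off the coordinates.\<close>
    have "\<alpha> * eis_cnj \<beta> dvd of_int (r - r') * eis_cnj \<beta>"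
      using dvd by (simp add: s mult_dvd_mono)
    then have "of_int (g * N) dvd of_int ((r - r') * (a - b)) + of_int ((r - r') * - b) * eis_omega"
      unfolding \<alpha>_cnj unfolding cnj by (simp only: distrib_left of_int_mult mult.assoc)
    then have "g * N dvd (r - r') * (a - b)" "g * N dvd (r - r') * - b"
      by (simp_all only: of_int_dvd_eis_iff)
    then have "g * N dvd gcd ((r - r') * (a - b)) ((r - r') * b)"
      by simp
    also have "gcd ((r - r') * (a - b)) ((r - r') * b) = \<bar>r - r'\<bar>"
      using coprime by (simp add: gcd_mult_distrib_int[symmetric])
    finally have "g * N dvd r - r'" by simp
    then have "r = r'"
      using rs zdvd_imp_le[of "g * N" "r - r'"] zdvd_imp_le[of "g * N" "r' - r"]
      by (cases r r' rule: linorder_cases) (auto simp: dvd_diff_commute)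
    then show ?thesis by (simp add: rs s)
  qed
  ultimately show ?thesis by metis
qed

section \<open>The cubic residue character\<close>

abbreviation cube_roots :: "eisenstein set" where
  "cube_roots \<equiv> {1, eis_omega, eis_omega\<^sup>2}"

lemma eis_omega_power2: "eis_omega\<^sup>2 = - 1 - eis_omega"
  by (simp add: power2_eq_square eis_omega_square)

lemma eis_omega_cube: "eis_omega ^ 3 = 1"
  by (simp add: power3_eq_cube eis_omega_square left_diff_distrib)

lemma cube_roots_cube: "u \<in> cube_roots \<Longrightarrow> u ^ 3 = 1"
proof -
  have "(eis_omega\<^sup>2) ^ 3 = (eis_omega ^ 3)\<^sup>2" by (simp flip: power_mult)
  then show "u \<in> cube_roots \<Longrightarrow> u ^ 3 = 1" by (auto simp: eis_omega_cube)
qed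

lemma cube_roots_mult: "u \<in> cube_roots \<Longrightarrow> v \<in> cube_roots \<Longrightarrow> u * v \<in> cube_roots"
proof -
  have "eis_omega * eis_omega\<^sup>2 = 1" "eis_omega\<^sup>2 * eis_omega = 1" "eis_omega\<^sup>2 * eis_omega\<^sup>2 = eis_omega"
    by (simp_all add: eis_omega_power2 eis_omega_square algebra_simps)
  moreover assume "u \<in> cube_roots" "v \<in> cube_roots"
  ultimately show ?thesis by (auto simp: power2_eq_square[symmetric])
qed

text \<open>Conjugation inverts roots of unity, and the inverse of a cube root of unity is its
  square. Zero is included as a value of the character.\<close>

lemma eis_cnj_cube_roots: "u \<in> insert 0 cube_roots \<Longrightarrow> eis_cnj u = u\<^sup>2"
proof -
  have "eis_cnj eis_omega = eis_omega\<^sup>2"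
    unfolding eis_omega_power2 by transfer (rule complex_omega_cnj)
  moreover from this have "eis_cnj (eis_omega\<^sup>2) = (eis_omega\<^sup>2)\<^sup>2"
    by (simp add: power2_eq_square eis_cnj_mult)
  moreover have "eis_cnj 0 = 0" "eis_cnj 1 = 1" by (transfer; simp)+
  ultimately show "u \<in> insert 0 cube_roots \<Longrightarrow> eis_cnj u = u\<^sup>2" by auto
qed

lemma eis_cnj_sum: "eis_cnj (sum f A) = (\<Sum>x\<in>A. eis_cnj (f x))"
proof (induction A rule: infinite_finite_induct)
  case (insert x A)
  have "eis_cnj (a + b) = eis_cnj a + eis_cnj b" for a b by transfer simp
  with insert show ?case by simp
qed (transfer; simp)+

lemma eis_primaryE:
  assumes "eis_primary \<alpha>"
  obtains a b where "\<alpha> = of_int (3 * a - 1) + of_int (3 * b) * eis_omega"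
proof -
  obtain a b where \<alpha>: "\<alpha> = of_int a + of_int b * eis_omega" by (rule eisenstein_cases)
  have "a mod 3 = 2" "b mod 3 = 0" using assms unfolding \<alpha> eis_primary_iff by simp_all
  then have "a = 3 * (a div 3 + 1) - 1" "b = 3 * (b div 3)" by presburger+
  then show thesis using \<alpha> that by metis
qed

text \<open>\<open>k\<close> is the exponent by which the character is defined, and will be the
  number of residues with a given nonzero character.\<close>

locale primary_eis_prime = finite_residue_field \<pi> R for \<pi> :: eisenstein and R +
  fixes k :: nat
  assumes primary: "eis_primary \<pi>"
    and card_R: "card R = 3 * k + 1"
    and norm_\<pi>: "eis_norm \<pi> = int (card R)"
begin

abbreviation \<chi> :: "eisenstein \<Rightarrow> eisenstein" where
  "\<chi> \<equiv> cubic_char \<pi>"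

lemma k_pos: "k > 0"
proof (rule ccontr)
  assume "\<not> k > 0"
  then have "card R = 1" using card_R by simp
  then obtain r where "R = {r}" by (rule card_1_singletonE)
  then have "rep 1 = rep 0" using rep_in[of 0] rep_in[of 1] by auto
  then have "\<pi> dvd 1 - 0"
    using dvd_minus_rep[of 0] dvd_minus_rep[of 1] by (metis cong_sym cong_trans)
  then show False using not_dvd_1 by simp
qed

lemma card_R_gt_2: "2 < card R"
  using card_R k_pos by simp

lemma not_dvd_omega: "\<not> \<pi> dvd eis_omega"
  using not_dvd_1 eis_omega_cube by (metis dvd_mult2 power3_eq_cube)

text \<open>The norm of \<open>1 - \<omega>\<close> is 3, too small for a multiple of
  \<open>3 k + 1\<close> with \<open>k > 0\<close>.\<close>

lemma not_dvd_one_minus_omega: "\<not> \<pi> dvd 1 - eis_omega"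
proof
  assume "\<pi> dvd 1 - eis_omega"
  then have "eis_norm \<pi> dvd eis_norm (1 - eis_omega)"
    by (auto elim!: dvdE simp: eis_norm_mult)
  also have "eis_norm (1 - eis_omega) = 3"
    using eis_norm_eq[of 1 "-1"] by simp
  finally have "3 * int k + 1 \<le> 3"
    unfolding norm_\<pi> card_R using zdvd_imp_le by fastforce
  then have "k = 0" by simp
  with k_pos show False by simp
qed

text \<open>Distinct cube roots of unity differ by a unit times \<open>1 - \<omega>\<close>. This
  upgrades congruences between character values to equations.\<close>

lemma cube_roots_incongruent:
  assumes "u \<in> insert 0 cube_roots" "v \<in> insert 0 cube_roots" "\<pi> dvd u - v"
  shows "u = v"
proof -
  have "1 - eis_omega\<^sup>2 = (1 - eis_omega) * - (eis_omega * eis_omega)"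
    "eis_omega - eis_omega\<^sup>2 = eis_omega * (1 - eis_omega)"
    by (simp_all add: eis_omega_power2 eis_omega_square algebra_simps)
  then have "\<not> \<pi> dvd 1 - eis_omega\<^sup>2" "\<not> \<pi> dvd eis_omega - eis_omega\<^sup>2" "\<not> \<pi> dvd eis_omega\<^sup>2"
    using not_dvd_omega not_dvd_one_minus_omega
    by (simp_all only: dvd_mult_iff dvd_minus_iff power2_eq_square) simp_all
  with assms show ?thesis
    using not_dvd_omega not_dvd_one_minus_omega not_dvd_1 by (auto dest: cong_sym)
qed

lemma omega_neq: "eis_omega \<noteq> 0" "eis_omega\<^sup>2 \<noteq> 0" "eis_omega \<noteq> 1" "eis_omega\<^sup>2 \<noteq> 1"
    "eis_omega\<^sup>2 \<noteq> eis_omega"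
proof -
  show "eis_omega \<noteq> 0" "eis_omega \<noteq> 1" using not_dvd_omega not_dvd_one_minus_omega by auto
  then show "eis_omega\<^sup>2 \<noteq> 0" "eis_omega\<^sup>2 \<noteq> eis_omega" by (auto simp: power2_eq_square)
  then show "eis_omega\<^sup>2 \<noteq> 1" using eis_omega_cube \<open>eis_omega \<noteq> 1\<close>
    by (metis mult_1 power2_eq_square power3_eq_cube)
qed

text \<open>For a nonzero residue \<open>x\<close>, Fermat makes \<open>\<pi>\<close> divide
  \<open>x ^ (3 * k) - 1\<close>, the product of the differences of \<open>x ^ k\<close> and the
  cube roots of unity. Being prime, \<open>\<pi>\<close> divides one of them, and by incongruence
  only one.\<close>

lemma chi_values: "\<chi> x \<in> insert 0 cube_roots" and cong_chi: "\<pi> dvd x ^ k - \<chi> x"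
  and chi_eq_0_iff: "\<chi> x = 0 \<longleftrightarrow> \<pi> dvd x"
proof -
  have "\<chi> x \<in> cube_roots \<and> \<pi> dvd x ^ k - \<chi> x" if x: "\<not> \<pi> dvd x"
  proof -
    have "\<pi> dvd x ^ (3 * k) - 1" using fermat[OF x] by (simp add: card_R)
    also have "x ^ (3 * k) - 1 = (x ^ k - 1) * ((x ^ k - eis_omega) * (x ^ k - eis_omega\<^sup>2))"
      unfolding eis_omega_power2 mult.commute[of 3] power_mult
      by (simp add: algebra_simps power3_eq_cube eis_omega_square)
    finally obtain u where u: "u \<in> cube_roots" "\<pi> dvd x ^ k - u"
      by (auto simp: dvd_mult_iff)
    have unique: "v = u" if "v \<in> cube_roots" "\<pi> dvd x ^ k - v" for v
      using that u cong_trans[OF cong_sym[OF that(2)] u(2)] by (intro cube_roots_incongruent) auto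
    have "\<exists>!u. u \<in> cube_roots \<and> eis_cong \<pi> (x ^ k) u"
    proof (rule ex1I[of _ u])
      show "u \<in> cube_roots \<and> eis_cong \<pi> (x ^ k) u"
        unfolding eis_cong_def by (rule conjI[OF u])
    qed (unfold eis_cong_def, elim conjE, rule unique)
    moreover have "nat ((eis_norm \<pi> - 1) div 3) = k" by (simp add: norm_\<pi> card_R)
    ultimately show ?thesis
      using theI'[of "\<lambda>u. u \<in> cube_roots \<and> eis_cong \<pi> (x ^ k) u"] x
      unfolding cubic_char_def eis_cong_def by simp
  qed
  moreover have "\<chi> x = 0 \<and> \<pi> dvd x ^ k" if "\<pi> dvd x"
    using that k_pos by (simp add: cubic_char_def dvd_power_iff dvd_trans[OF that])
  ultimately show "\<chi> x \<in> insert 0 cube_roots" "\<pi> dvd x ^ k - \<chi> x" "\<chi> x = 0 \<longleftrightarrow> \<pi> dvd x"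
    using omega_neq by (cases "\<pi> dvd x"; force)+
qed

lemma chi_eqI:
  assumes "v \<in> insert 0 cube_roots" "\<pi> dvd x ^ k - v"
  shows "\<chi> x = v"
  by (rule cube_roots_incongruent[OF chi_values assms(1) cong_trans[OF cong_sym[OF cong_chi] assms(2)]])

lemma chi_in_cube_roots: "\<not> \<pi> dvd x \<Longrightarrow> \<chi> x \<in> cube_roots"
  using chi_values[of x] chi_eq_0_iff[of x] by blast

lemma chi_cube: "\<not> \<pi> dvd x \<Longrightarrow> \<chi> x ^ 3 = 1"
  by (intro cube_roots_cube chi_in_cube_roots)

lemma chi_cong: "\<pi> dvd x - y \<Longrightarrow> \<chi> x = \<chi> y"
  by (rule chi_eqI[OF chi_values cong_trans[OF cong_power cong_chi]])

lemma chi_mult: "\<chi> (x * y) = \<chi> x * \<chi> y"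
proof (rule chi_eqI)
  show "\<chi> x * \<chi> y \<in> insert 0 cube_roots"
    using chi_values[of x] chi_values[of y] cube_roots_mult[of "\<chi> x" "\<chi> y"] by auto
  show "\<pi> dvd (x * y) ^ k - \<chi> x * \<chi> y"
    unfolding power_mult_distrib by (rule cong_mult[OF cong_chi cong_chi])
qed

lemma chi_1 [simp]: "\<chi> 1 = 1"
  by (rule chi_eqI) auto

lemma chi_0 [simp]: "\<chi> 0 = 0"
  by (simp add: chi_eq_0_iff)

text \<open>\<open>-1\<close> is its own cube, and nonzero character values have cube 1.\<close>

lemma chi_minus: "\<chi> (- x) = \<chi> x"
proof -
  have "\<chi> (- 1) = \<chi> (- 1) ^ 3"
    using chi_mult[of "- 1" "- 1"] chi_mult[of "- 1" 1] by (simp add: power3_eq_cube)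
  also have "\<dots> = 1" using not_dvd_1 by (intro chi_cube) simp
  finally show ?thesis using chi_mult[of "- 1" x] by simp
qed

lemma chi_prod: "\<chi> (prod f A) = (\<Prod>x\<in>A. \<chi> (f x))"
  by (induction A rule: infinite_finite_induct) (simp_all add: chi_mult)

lemma chi_mult_inverse: "\<not> \<pi> dvd x \<Longrightarrow> \<chi> x * \<chi> (cong_inverse x) = 1"
  using chi_cong[OF cong_mult_inverse[OF _ card_R_gt_2, of x]] by (simp add: chi_mult)

lemma chi_inverse: "\<chi> (cong_inverse x) = (\<chi> x)\<^sup>2"
proof (cases "\<pi> dvd x")
  case True
  then show ?thesis
    using card_R_gt_2 dvd_cong_inverse_iff[of x] chi_eq_0_iff[of x] chi_eq_0_iff[of "cong_inverse x"] by simp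
next
  case False
  have "\<chi> (cong_inverse x) = \<chi> x ^ 3 * \<chi> (cong_inverse x)" by (simp add: chi_cube[OF False])
  also have "\<dots> = (\<chi> x)\<^sup>2 * (\<chi> x * \<chi> (cong_inverse x))"
    by (simp add: power2_eq_square power3_eq_cube mult_ac)
  finally show ?thesis by (simp add: chi_mult_inverse[OF False])
qed

text \<open>Each class consists of roots of \<open>X^k - u\<close>, so it has at most
  \<open>k\<close> elements; as the three classes cover \<open>3 k\<close> nonzero representatives,
  none is smaller.\<close>

lemma card_chi_eq:
  assumes "u \<in> cube_roots"
  shows "card {x \<in> R. \<chi> x = u} = k"
proof -
  let ?C = "\<lambda>u. {x \<in> R. \<chi> x = u}"
  have le: "card (?C u) \<le> k" for u
  proof -
    have "card (?C u) \<le> card {x \<in> R. \<pi> dvd x ^ k - u}"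
      using finite_R cong_chi by (intro card_mono) auto
    then show ?thesis using card_roots_le[OF k_pos, of u] by linarith
  qed
  have "{x \<in> R. \<not> \<pi> dvd x} \<subseteq> ?C 1 \<union> (?C eis_omega \<union> ?C (eis_omega\<^sup>2))"
    using chi_in_cube_roots by auto
  then have "3 * k \<le> card (?C 1 \<union> (?C eis_omega \<union> ?C (eis_omega\<^sup>2)))"
    using finite_R card_R_nonzero card_R
      card_mono[of "?C 1 \<union> (?C eis_omega \<union> ?C (eis_omega\<^sup>2))" "{x \<in> R. \<not> \<pi> dvd x}"] by simp
  also have "\<dots> \<le> card (?C 1) + (card (?C eis_omega) + card (?C (eis_omega\<^sup>2)))"
    by (rule order_trans[OF card_Un_le add_left_mono[OF card_Un_le]])
  finally show ?thesis
    using assms le[of 1] le[of eis_omega] le[of "eis_omega\<^sup>2"] by auto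
qed

text \<open>\<open>X^k - u\<close> and the product of linear factors over its \<open>k\<close> roots
  are monic of degree \<open>k\<close>. Their difference has smaller degree and still
  \<open>k\<close> roots, so it vanishes modulo \<open>\<pi>\<close>.\<close>

lemma cong_prod_chi_class:
  assumes "u \<in> cube_roots"
  shows "\<pi> dvd (y ^ k - u) - (\<Prod>x\<in>{x \<in> R. \<chi> x = u}. y - x)"
proof -
  let ?C = "{x \<in> R. \<chi> x = u}"
  let ?P = "\<Prod>x\<in>?C. [:- x, 1:]"
  let ?f = "monom 1 k - [:u:] - ?P"
  have P: "degree ?P = k"
    using card_chi_eq[OF assms] by (simp add: degree_prod_eq_sum_degree)
  have "lead_coeff ?P = 1" by (simp only: lead_coeff_prod) simp
  then have "coeff ?P k = 1" unfolding P .
  then have "coeff ?f k = 0" using k_pos by (cases k) auto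
  moreover have "degree ?f \<le> k"
    using P by (intro degree_diff_le) (auto simp: degree_monom_eq)
  moreover have "degree f < k" if "coeff f k = 0" "degree f \<le> k" for f :: "eisenstein poly"
    using that k_pos leading_coeff_0_iff[of f] by (cases "degree f = k") auto
  ultimately have "degree ?f < k" by blast
  moreover have "\<pi> dvd poly ?f x" if "x \<in> ?C" for x
  proof -
    have "poly ?P x = 0" using that finite_R by (auto simp: poly_prod prod_zero_iff)
    then show ?thesis using that cong_chi[of x] by (auto simp: poly_monom)
  qed
  ultimately have "[:\<pi>:] dvd ?f"
    using card_chi_eq[OF assms] by (intro lagrange[of ?C]) auto
  then have "\<pi> dvd poly ?f y" by (rule const_dvd_imp_dvd_poly)
  then show ?thesis by (simp add: poly_monom poly_prod)
qed

section \<open>Cyclotomic numbers of order 3\<close>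

text \<open>Since \<open>\<chi> (- x) = \<chi> x\<close>, these are the classical numbers counting
  \<open>x\<close> by the characters of \<open>x\<close> and \<open>1 + x\<close>, indexed by values
  instead of exponents.\<close>

definition cyclotomic_number :: "eisenstein \<Rightarrow> eisenstein \<Rightarrow> nat" where
  "cyclotomic_number u v = card {x \<in> R. \<chi> x = u \<and> \<chi> (1 - x) = v}"

lemma chi_one_minus_omega:
  "\<chi> (1 - eis_omega) = eis_omega ^ (cyclotomic_number eis_omega eis_omega +
     2 * cyclotomic_number eis_omega (eis_omega\<^sup>2))"
proof -
  let ?C = "{x \<in> R. \<chi> x = eis_omega}"
  let ?D = "\<lambda>v. {x \<in> R. \<chi> x = eis_omega \<and> \<chi> (1 - x) = v}"
  have "\<chi> (1 - eis_omega) = (\<Prod>x\<in>?C. \<chi> (1 - x))"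
    using cong_prod_chi_class[of eis_omega 1] by (simp add: chi_prod[symmetric] chi_cong)
  also have "\<dots> = (\<Prod>x\<in>?C. (if \<chi> (1 - x) = eis_omega then eis_omega else 1) *
      (if \<chi> (1 - x) = eis_omega\<^sup>2 then eis_omega\<^sup>2 else 1))"
  proof (rule prod.cong)
    fix x assume "x \<in> ?C"
    \<comment> \<open>Otherwise \<open>\<chi> x\<close> would be \<open>\<chi> 1 = 1\<close> instead
      of \<open>\<omega>\<close>.\<close>
    then have "\<not> \<pi> dvd 1 - x"
      using chi_cong[of 1 x] omega_neq by auto
    then show "\<chi> (1 - x) = (if \<chi> (1 - x) = eis_omega then eis_omega else 1) *
      (if \<chi> (1 - x) = eis_omega\<^sup>2 then eis_omega\<^sup>2 else 1)"
      using chi_in_cube_roots[of "1 - x"] omega_neq by auto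
  qed simp
  also have "\<dots> = (\<Prod>x\<in>?D eis_omega. eis_omega) * (\<Prod>x\<in>?D (eis_omega\<^sup>2). eis_omega\<^sup>2)"
    unfolding prod.distrib using finite_R
    by (intro arg_cong2[where f = "(*)"] prod.mono_neutral_cong_right) auto
  finally show ?thesis by (simp add: cyclotomic_number_def power_add power_mult)
qed

lemma cyclotomic_number_commute: "cyclotomic_number u v = cyclotomic_number v u"
proof -
  have "card {x \<in> R. \<chi> (1 - x) = v \<and> \<chi> (1 - (1 - x)) = u} = card {x \<in> R. \<chi> x = v \<and> \<chi> (1 - x) = u}"
  proof (rule card_reindex)
    fix x y :: eisenstein
    assume "\<pi> dvd x - y"
    then have "\<chi> x = \<chi> y" "\<chi> (1 - x) = \<chi> (1 - y)"
      using chi_cong[of "1 - x" "1 - y"] chi_cong[of x y] by (auto dest: cong_sym)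
    then show "(\<chi> x = v \<and> \<chi> (1 - x) = u) \<longleftrightarrow> (\<chi> y = v \<and> \<chi> (1 - y) = u)" by simp
  qed (auto dest: cong_sym)
  then show ?thesis unfolding cyclotomic_number_def by (simp add: conj_commute)
qed

text \<open>Because \<open>1 - 1/x = - (1 - x) / x\<close>, where the sign has character 1 and
  inverting \<open>x\<close> squares its character.\<close>

lemma chi_one_minus_inverse:
  assumes "\<not> \<pi> dvd x"
  shows "\<chi> (1 - cong_inverse x) = \<chi> (1 - x) * (\<chi> x)\<^sup>2"
proof -
  have "\<pi> dvd (1 - cong_inverse x) - - ((1 - x) * cong_inverse x)"
    using cong_sym[OF cong_mult_inverse[OF assms card_R_gt_2]] by (simp add: algebra_simps)
  then show ?thesis
    using chi_cong chi_minus chi_mult chi_inverse by metis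
qed

text \<open>The effect of the substitution \<open>x \<mapsto> 1/x\<close> on both
  characters.\<close>

lemma cyclotomic_number_inverse:
  assumes "u \<in> cube_roots"
  shows "cyclotomic_number u v = cyclotomic_number (u\<^sup>2) (v * u\<^sup>2)"
proof -
  let ?P = "\<lambda>x. \<chi> x = u\<^sup>2 \<and> \<chi> (1 - x) = v * u\<^sup>2"
  have u: "u ^ 3 = 1" using assms by (rule cube_roots_cube)
  have "u \<noteq> 0" using assms omega_neq by auto
  have "card {x \<in> R. ?P (cong_inverse x)} = card {x \<in> R. ?P x}"
  proof (rule card_reindex)
    show "\<pi> dvd x - y" if "\<pi> dvd cong_inverse x - cong_inverse y" for x y
      using that card_R_gt_2 by (rule cong_inverse_inj)
    show "?P x \<longleftrightarrow> ?P y" if "\<pi> dvd x - y" for x y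
      using that chi_cong[of "1 - x" "1 - y"] chi_cong[of x y] by (auto dest: cong_sym)
  qed
  also have "{x \<in> R. ?P (cong_inverse x)} = {x \<in> R. \<chi> x = u \<and> \<chi> (1 - x) = v}"
  proof (rule Collect_cong, rule conj_cong[OF refl])
    fix x
    show "?P (cong_inverse x) \<longleftrightarrow> \<chi> x = u \<and> \<chi> (1 - x) = v"
    proof (cases "\<pi> dvd x")
      case True
      then show ?thesis using \<open>u \<noteq> 0\<close> chi_eq_0_iff[of x] by (auto simp: chi_inverse)
    next
      case False
      \<comment> \<open>Squaring is injective on cube roots of unity, being inversion there.\<close>
      have "a = b" if "a\<^sup>2 = b\<^sup>2" "a ^ 3 = 1" "b ^ 3 = 1" for a b :: eisenstein
      proof -
        have "a = a * b ^ 3" using that by simp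
        also have "\<dots> = a ^ 3 * b" using that(1) by (simp add: power2_eq_square power3_eq_cube mult_ac)
        finally show ?thesis using that by simp
      qed
      then have "(\<chi> x)\<^sup>2 = u\<^sup>2 \<longleftrightarrow> \<chi> x = u" using u chi_cube[OF False] by blast
      then show ?thesis
        using \<open>u \<noteq> 0\<close> by (auto simp: chi_inverse chi_one_minus_inverse[OF False])
    qed
  qed
  finally show ?thesis by (simp add: cyclotomic_number_def)
qed

text \<open>The \<open>k\<close> residues of character \<open>u\<close> are sorted by the character
  of \<open>1 - x\<close>. Only the class of 1 gives the value 0, and its own character is 1; hence
  the correction.\<close>

lemma sum_cyclotomic_number:
  assumes "u \<in> cube_roots"
  shows "(\<Sum>v\<in>cube_roots. cyclotomic_number u v) = k - of_bool (u = 1)"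
proof -
  let ?D = "\<lambda>v. {x \<in> R. \<chi> x = u \<and> \<chi> (1 - x) = v}"
  have *: "\<chi> x = u \<and> \<chi> (1 - x) = 0 \<longleftrightarrow> x = rep 1 \<and> u = 1" if "x \<in> R" for x
    using that chi_eq_0_iff[of "1 - x"] chi_cong[of 1 x] dvd_minus_rep[of 1]
      cong_R_eq[of x "rep 1"] by (auto intro: cong_trans cong_sym)
  have "?D 0 = (if u = 1 then {rep 1} else {})"
  proof (rule set_eqI)
    show "x \<in> ?D 0 \<longleftrightarrow> x \<in> (if u = 1 then {rep 1} else {})" for x
      using *[of x] rep_in[of 1] by auto
  qed
  then have D0: "card (?D 0) = of_bool (u = 1)" by simp
  have "(\<Sum>v\<in>insert 0 cube_roots. card (?D v)) = card (\<Union>v\<in>insert 0 cube_roots. ?D v)"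
    using finite_R by (intro card_UN_disjoint[symmetric]) auto
  also have "(\<Union>v\<in>insert 0 cube_roots. ?D v) = {x \<in> R. \<chi> x = u}"
    using chi_values by blast
  also have "card \<dots> = k" using assms by (rule card_chi_eq)
  finally show ?thesis
    using D0 omega_neq by (simp add: cyclotomic_number_def)
qed

section \<open>The Jacobi sum\<close>

definition jacobi_sum :: eisenstein where
  "jacobi_sum = (\<Sum>x\<in>R. \<chi> x * \<chi> (1 - x))"

lemma jacobi_sum_cyclotomic:
  "jacobi_sum = (\<Sum>u\<in>cube_roots. \<Sum>v\<in>cube_roots. of_nat (cyclotomic_number u v) * (u * v))"
proof -
  have "\<chi> x * \<chi> (1 - x) = (\<Sum>u\<in>cube_roots. \<Sum>v\<in>cube_roots. of_bool (\<chi> x = u \<and> \<chi> (1 - x) = v) * (u * v))" for x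
    using chi_values[of x] chi_values[of "1 - x"] omega_neq by auto
  then have "jacobi_sum = (\<Sum>x\<in>R. \<Sum>u\<in>cube_roots. \<Sum>v\<in>cube_roots. of_bool (\<chi> x = u \<and> \<chi> (1 - x) = v) * (u * v))"
    by (simp only: jacobi_sum_def)
  also have "\<dots> = (\<Sum>u\<in>cube_roots. \<Sum>x\<in>R. \<Sum>v\<in>cube_roots. of_bool (\<chi> x = u \<and> \<chi> (1 - x) = v) * (u * v))"
    by (rule sum.swap)
  also have "\<dots> = (\<Sum>u\<in>cube_roots. \<Sum>v\<in>cube_roots. \<Sum>x\<in>R. of_bool (\<chi> x = u \<and> \<chi> (1 - x) = v) * (u * v))"
    by (intro sum.cong refl sum.swap)
  also have "\<dots> = (\<Sum>u\<in>cube_roots. \<Sum>v\<in>cube_roots. of_nat (cyclotomic_number u v) * (u * v))"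
    unfolding sum_distrib_right[symmetric] cyclotomic_number_def
    using finite_R by (simp add: Int_def)
  finally show ?thesis .
qed

text \<open>Modulo \<open>\<pi>\<close> this sums the values of \<open>X^k (1 - X)^k\<close>, whose
  degree \<open>2 k\<close> is below \<open>card R - 1 = 3 k\<close>.\<close>

lemma dvd_jacobi_sum: "\<pi> dvd jacobi_sum"
proof -
  let ?f = "[:0, 1:] ^ k * [:1, - 1:] ^ k :: eisenstein poly"
  have "degree ?f < card R - 1"
    using card_R k_pos degree_mult_le[of "[:0, 1:] ^ k" "[:1, - 1:] ^ k :: eisenstein poly"]
    by (simp add: degree_power_eq)
  then have "\<pi> dvd (\<Sum>x\<in>R. poly ?f x)" by (rule dvd_sum_poly)
  moreover have "\<pi> dvd (\<Sum>x\<in>R. poly ?f x) - jacobi_sum"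
    unfolding jacobi_sum_def using cong_chi
    by (intro cong_sum) (auto simp: poly_power intro!: cong_mult)
  ultimately show ?thesis by (metis dvd_diff_right_iff dvd_minus_iff diff_minus_eq_add dvd_add_right_iff)
qed

section \<open>Character sums and the norm of the Jacobi sum\<close>

text \<open>Some \<open>c\<close> has character \<open>\<omega>\<close>; replacing \<open>x\<close>
  by \<open>c x\<close> multiplies the sum by \<open>\<omega> ^ j\<close>.\<close>

lemma sum_chi_power:
  assumes "eis_omega ^ j \<noteq> 1"
  shows "(\<Sum>x\<in>R. \<chi> x ^ j) = 0"
proof -
  have "card {x \<in> R. \<chi> x = eis_omega} \<noteq> 0" using card_chi_eq k_pos by simp
  then obtain c where c: "\<chi> c = eis_omega" using finite_R by (auto simp: card_eq_0_iff)
  then have "\<not> \<pi> dvd c" using chi_eq_0_iff[of c] omega_neq by simp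
  then have "(\<Sum>x\<in>R. \<chi> (c * x) ^ j) = (\<Sum>x\<in>R. \<chi> x ^ j)"
    using chi_cong by (intro sum_reindex[of "\<lambda>x. c * x" "\<lambda>x. \<chi> x ^ j"])
      (auto dest: cong_mult_cancel intro: arg_cong[where f = "\<lambda>z. z ^ j"])
  then have "(eis_omega ^ j - 1) * (\<Sum>x\<in>R. \<chi> x ^ j) = 0"
    by (simp add: chi_mult c power_mult_distrib sum_distrib_left[symmetric] left_diff_distrib)
  with assms show ?thesis by simp
qed

lemma sum_chi: "(\<Sum>x\<in>R. \<chi> x) = 0" and sum_chi_square: "(\<Sum>x\<in>R. (\<chi> x)\<^sup>2) = 0"
  using sum_chi_power[of 1] sum_chi_power[of 2] omega_neq by auto

text \<open>The affine map permutes the residues unless \<open>t\<close> is congruent to 1, when all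
  its values are congruent to 1.\<close>

lemma sum_chi_linear:
  "(\<Sum>z\<in>R. \<chi> ((1 - t) * z + t)) = (if \<pi> dvd 1 - t then of_nat (card R) else 0)"
proof (cases "\<pi> dvd 1 - t")
  case True
  have "\<chi> ((1 - t) * z + t) = 1" for z
  proof -
    have "((1 - t) * z + t) - 1 = (1 - t) * (z - 1)" by (simp add: algebra_simps)
    then have "\<pi> dvd ((1 - t) * z + t) - 1" using True by simp
    then show ?thesis using chi_cong by fastforce
  qed
  with True show ?thesis by simp
next
  case False
  then have "(\<Sum>z\<in>R. \<chi> ((1 - t) * z + t)) = (\<Sum>z\<in>R. \<chi> z)"
    using chi_cong by (intro sum_reindex) (auto dest: cong_mult_cancel)
  with False show ?thesis by (simp add: sum_chi)
qed

text \<open>Squaring inverts nonzero character values, so this sums the character of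
  \<open>(1 - t y) / (1 - y)\<close>. The substitution \<open>y = 1 - 1/z\<close> turns the quotient
  into \<open>(1 - t) z + t\<close>; the term \<open>\<chi> t\<close> at \<open>z = 0\<close> is
  missing.\<close>

lemma sum_chi_quotient:
  "(\<Sum>y\<in>R. \<chi> (1 - t * y) * (\<chi> (1 - y))\<^sup>2)
     = (if \<pi> dvd 1 - t then of_nat (card R) else 0) - \<chi> t"
proof -
  let ?f = "\<lambda>y. \<chi> (1 - t * y) * (\<chi> (1 - y))\<^sup>2"
  let ?g = "\<lambda>z. \<chi> (1 - t * (1 - z)) * (\<chi> z)\<^sup>2"
  have f: "?f x = ?f y" if "\<pi> dvd x - y" for x y
  proof -
    have "\<pi> dvd (1 - t * x) - (1 - t * y)" "\<pi> dvd (1 - x) - (1 - y)"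
      using dvd_mult[OF cong_sym[OF that], of t] cong_sym[OF that] by (simp_all add: algebra_simps)
    then show ?thesis using chi_cong by metis
  qed
  have g: "?g x = ?g y" if "\<pi> dvd x - y" for x y
    using f[of "1 - x" "1 - y"] cong_sym[OF that] by simp
  have "(\<Sum>y\<in>R. ?f y) = (\<Sum>z\<in>R. ?f (1 - z))"
    using f by (intro sum_reindex[symmetric]) (auto dest: cong_sym)
  also have "\<dots> = (\<Sum>z\<in>R. ?g z)" by simp
  also have "\<dots> = (\<Sum>z\<in>R. ?g (cong_inverse z))"
    using g cong_inverse_inj card_R_gt_2 by (intro sum_reindex[symmetric]) auto
  also have "\<dots> = (\<Sum>z\<in>R. of_bool (\<not> \<pi> dvd z) * \<chi> ((1 - t) * z + t))"
  proof (rule sum.cong)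
    fix z
    show "?g (cong_inverse z) = of_bool (\<not> \<pi> dvd z) * \<chi> ((1 - t) * z + t)"
    proof (cases "\<pi> dvd z")
      case True
      then show ?thesis using chi_eq_0_iff[of z] by (simp add: chi_inverse)
    next
      case False
      have "(\<chi> (cong_inverse z))\<^sup>2 = \<chi> z * \<chi> z ^ 3"
        unfolding chi_inverse by (simp add: power2_eq_square power3_eq_cube mult_ac)
      then have "?g (cong_inverse z) = \<chi> ((1 - t * (1 - cong_inverse z)) * z)"
        by (simp add: chi_cube[OF False] chi_mult)
      also have "\<dots> = \<chi> ((1 - t) * z + t)"
      proof (rule chi_cong)
        have "(1 - t * (1 - cong_inverse z)) * z - ((1 - t) * z + t) = t * (z * cong_inverse z - 1)"
          by (simp add: algebra_simps)
        then show "\<pi> dvd (1 - t * (1 - cong_inverse z)) * z - ((1 - t) * z + t)"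
          using cong_mult_inverse[OF False card_R_gt_2] by simp
      qed
      finally show ?thesis using False by simp
    qed
  qed simp
  also have "\<dots> = (\<Sum>z\<in>R. \<chi> ((1 - t) * z + t)) - \<chi> t"
  proof -
    have "\<chi> ((1 - t) * x + t) = \<chi> ((1 - t) * y + t)" if "\<pi> dvd x - y" for x y
      using dvd_mult[OF that, of "1 - t"] by (intro chi_cong) (simp add: algebra_simps)
    from sum_split_zero[of "\<lambda>z. \<chi> ((1 - t) * z + t)", OF this] show ?thesis by simp
  qed
  finally show ?thesis by (simp only: sum_chi_linear)
qed

text \<open>Substituting \<open>x = t y\<close> in the product of the sum and its conjugate makes
  the inner sum over \<open>y\<close> the quotient sum. Only \<open>t\<close> congruent to 1
  contributes, as the sums of \<open>\<chi>\<close> and of its square vanish.\<close>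

lemma norm_jacobi_sum: "eis_norm jacobi_sum = int (card R)"
proof -
  let ?h = "\<lambda>t y. \<chi> (1 - t * y) * (\<chi> (1 - y))\<^sup>2"
  have "of_int (eis_norm jacobi_sum) = jacobi_sum * eis_cnj jacobi_sum" by (rule eis_norm_cnj)
  also have "eis_cnj jacobi_sum = (\<Sum>y\<in>R. (\<chi> y * \<chi> (1 - y))\<^sup>2)"
    unfolding jacobi_sum_def eis_cnj_sum eis_cnj_mult
    by (simp only: eis_cnj_cube_roots chi_values power_mult_distrib)
  also have "jacobi_sum * \<dots> = (\<Sum>y\<in>R. \<Sum>x\<in>R. \<chi> x * \<chi> (1 - x) * (\<chi> y * \<chi> (1 - y))\<^sup>2)"
    unfolding jacobi_sum_def sum_product by (rule sum.swap)
  \<comment> \<open>The indicator records that terms with \<open>y\<close> in the zero class vanish;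
    for the others the factor \<open>\<chi> y ^ 3\<close> is 1.\<close>
  also have "\<dots> = (\<Sum>y\<in>R. \<Sum>t\<in>R. of_bool (\<not> \<pi> dvd y) * (\<chi> t * ?h t y))"
  proof (rule sum.cong)
    fix y
    show "(\<Sum>x\<in>R. \<chi> x * \<chi> (1 - x) * (\<chi> y * \<chi> (1 - y))\<^sup>2)
        = (\<Sum>t\<in>R. of_bool (\<not> \<pi> dvd y) * (\<chi> t * ?h t y))"
    proof (cases "\<pi> dvd y")
      case True
      then show ?thesis using chi_eq_0_iff[of y] by simp
    next
      case False
      let ?f = "\<lambda>x. \<chi> x * \<chi> (1 - x) * (\<chi> y * \<chi> (1 - y))\<^sup>2"
      have "(\<Sum>x\<in>R. ?f x) = (\<Sum>t\<in>R. ?f (y * t))"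
      proof (rule sum_reindex[symmetric])
        show "?f x = ?f x'" if "\<pi> dvd x - x'" for x x'
          using that chi_cong[of "1 - x" "1 - x'"] chi_cong[of x x'] by (auto dest: cong_sym)
      qed (use False in \<open>auto dest: cong_mult_cancel\<close>)
      also have "\<dots> = (\<Sum>t\<in>R. \<chi> y ^ 3 * (\<chi> t * ?h t y))"
        by (simp add: chi_mult power2_eq_square power3_eq_cube mult_ac)
      finally show ?thesis by (simp add: chi_cube[OF False] False)
    qed
  qed simp
  also have "\<dots> = (\<Sum>t\<in>R. \<chi> t * (\<Sum>y\<in>R. of_bool (\<not> \<pi> dvd y) * ?h t y))"
    by (subst sum.swap) (simp add: sum_distrib_left mult_ac)
  \<comment> \<open>Completing the inner sum by \<open>y = 0\<close> adds the term 1, which is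
    subtracted again.\<close>
  also have "\<dots> = (\<Sum>t\<in>R. \<chi> t * ((\<Sum>y\<in>R. ?h t y) - 1))"
  proof -
    have "?h t x = ?h t y" if "\<pi> dvd x - y" for x y t
    proof -
      have "\<pi> dvd (1 - t * x) - (1 - t * y)" "\<pi> dvd (1 - x) - (1 - y)"
        using dvd_mult[OF cong_sym[OF that], of t] cong_sym[OF that] by (simp_all add: algebra_simps)
      then show ?thesis using chi_cong by metis
    qed
    from sum_split_zero[of "?h t" for t, OF this] show ?thesis by simp
  qed
  also have "\<dots> = (\<Sum>t\<in>R. \<chi> t * (if \<pi> dvd 1 - t then of_nat (card R) else 0)) - (\<Sum>t\<in>R. (\<chi> t)\<^sup>2)
      - (\<Sum>t\<in>R. \<chi> t)"
    unfolding sum_chi_quotient sum_subtractf[symmetric]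
    by (intro sum.cong) (simp_all add: algebra_simps power2_eq_square)
  also have "\<dots> = (\<Sum>t\<in>R. if t = rep 1 then of_nat (card R) else 0)"
  proof -
    have "\<pi> dvd 1 - t \<longleftrightarrow> t = rep 1" if "t \<in> R" for t
      using that dvd_minus_rep[of 1] cong_R_eq[of t "rep 1"] by (auto intro: cong_trans cong_sym)
    moreover have "\<chi> (rep 1) = 1" using chi_cong[OF dvd_minus_rep[of 1]] by simp
    ultimately show ?thesis unfolding sum_chi sum_chi_square by (auto intro!: sum.cong)
  qed
  also have "\<dots> = of_int (int (card R))" using finite_R by simp
  finally show ?thesis by (simp only: of_int_eisenstein_eq_iff)
qed

text \<open>The symmetries reduce the nine counts to \<open>B\<close>, \<open>C\<close>,
  \<open>E\<close> and the count at \<open>(1, 1)\<close>, which the row sums determine.\<close>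

lemma jacobi_sum_coords:
  fixes B C E :: int
  defines "C \<equiv> int (cyclotomic_number eis_omega eis_omega)"
    and "E \<equiv> int (cyclotomic_number eis_omega (eis_omega\<^sup>2))"
    and "B \<equiv> int (cyclotomic_number 1 eis_omega)"
  shows "jacobi_sum = of_int (3 * (E - C) - 1) + of_int (3 * (B - C)) * eis_omega"
proof -
  let ?n = "\<lambda>u v. int (cyclotomic_number u v)"
  have omega4: "eis_omega\<^sup>2 * eis_omega\<^sup>2 = eis_omega" "eis_omega * eis_omega\<^sup>2 = 1"
      "eis_omega\<^sup>2 * eis_omega = 1"
      "eis_omega ^ 4 = eis_omega" "eis_omega ^ 6 = 1"
    by (simp_all add: eis_omega_power2 eis_omega_square eval_nat_numeral algebra_simps)
  have C: "?n 1 (eis_omega\<^sup>2) = C" "?n (eis_omega\<^sup>2) 1 = C"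
    using cyclotomic_number_inverse[of eis_omega eis_omega] cyclotomic_number_commute[of 1 "eis_omega\<^sup>2"]
    by (simp_all add: C_def omega4)
  have B: "?n eis_omega 1 = B" "?n (eis_omega\<^sup>2) (eis_omega\<^sup>2) = B"
    using cyclotomic_number_inverse[of "eis_omega\<^sup>2" "eis_omega\<^sup>2"] cyclotomic_number_commute[of 1 eis_omega]
    by (simp_all add: B_def omega4)
  have E: "?n (eis_omega\<^sup>2) eis_omega = E"
    using cyclotomic_number_commute[of "eis_omega\<^sup>2" eis_omega] by (simp add: E_def)
  have "?n 1 1 + (?n 1 eis_omega + ?n 1 (eis_omega\<^sup>2)) = int k - 1"
    using sum_cyclotomic_number[of 1] omega_neq omega_neq[symmetric] k_pos by (simp add: of_nat_diff flip: of_nat_add)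
  moreover have "?n eis_omega 1 + (?n eis_omega eis_omega + ?n eis_omega (eis_omega\<^sup>2)) = int k"
    using sum_cyclotomic_number[of eis_omega] omega_neq omega_neq[symmetric] by (simp flip: of_nat_add)
  \<comment> \<open>Both row sums contain \<open>B + C\<close>, and the first is smaller by 1. This
    is the source of the \<open>- 1\<close> in the rational coordinate.\<close>
  ultimately have A: "?n 1 1 = E - 1"
    using B C by (simp add: B_def C_def E_def)
  have "jacobi_sum = (\<Sum>u\<in>cube_roots. \<Sum>v\<in>cube_roots. of_int (?n u v) * (u * v))"
    using jacobi_sum_cyclotomic by simp
  also have "\<dots> = of_int (?n 1 1) + of_int (?n 1 eis_omega) * eis_omega + of_int (?n 1 (eis_omega\<^sup>2)) * eis_omega\<^sup>2
     + (of_int (?n eis_omega 1) * eis_omega + of_int (?n eis_omega eis_omega) * eis_omega\<^sup>2 + of_int (?n eis_omega (eis_omega\<^sup>2)))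
     + (of_int (?n (eis_omega\<^sup>2) 1) * eis_omega\<^sup>2 + of_int (?n (eis_omega\<^sup>2) eis_omega)
     + of_int (?n (eis_omega\<^sup>2) (eis_omega\<^sup>2)) * eis_omega)"
    using omega_neq omega_neq[symmetric] omega4 by (simp add: power2_eq_square[symmetric] mult.commute)
  also have "\<dots> = of_int (E - 1) + of_int B * eis_omega + of_int C * eis_omega\<^sup>2
     + (of_int B * eis_omega + of_int C * eis_omega\<^sup>2 + of_int E)
     + (of_int C * eis_omega\<^sup>2 + of_int E + of_int B * eis_omega)"
    unfolding A B C E by (simp only: B_def C_def E_def)
  also have "\<dots> = of_int (3 * (E - C) - 1) + of_int (3 * (B - C)) * eis_omega"
    unfolding eis_omega_power2 by (simp add: algebra_simps)
  finally show ?thesis .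
qed

text \<open>The quotient \<open>\<gamma>\<close> has norm 1 and, relating two primary elements, is 1
  modulo 3; the only such unit is 1.\<close>

lemma jacobi_sum_eq: "jacobi_sum = \<pi>"
proof -
  obtain \<gamma> where \<gamma>: "jacobi_sum = \<pi> * \<gamma>" using dvd_jacobi_sum by (elim dvdE)
  obtain c d where cd: "\<gamma> = of_int c + of_int d * eis_omega" by (rule eisenstein_cases)
  obtain a b where ab: "\<pi> = of_int (3 * a - 1) + of_int (3 * b) * eis_omega"
    using primary by (rule eis_primaryE)
  have "eis_norm \<gamma> = 1"
    using norm_jacobi_sum norm_\<pi> card_R by (simp add: \<gamma> eis_norm_mult)
  then have norm: "(2 * c - d)\<^sup>2 + 3 * d\<^sup>2 = 4" using four_eis_norm[of c d] by (simp add: cd)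
  obtain m' n' where coords: "jacobi_sum = of_int (3 * m' - 1) + of_int (3 * n') * eis_omega"
    using jacobi_sum_coords by blast
  have "\<pi> * \<gamma> = of_int (3 * m' - 1) + of_int (3 * n') * eis_omega"
    by (rule trans[OF \<gamma>[symmetric] coords])
  then have "(3 * a - 1) * c - 3 * b * d = 3 * m' - 1"
    "(3 * a - 1) * d + 3 * b * c - 3 * b * d = 3 * n'"
    unfolding ab cd eis_mult_coords eisenstein_eq_iff by simp_all
  \<comment> \<open>The coordinates of the product, solved for \<open>d\<close> and
    \<open>c - 1\<close>, show that 3 divides both.\<close>
  then have "d = 3 * (a * d + b * c - b * d - n')" "c - 1 = 3 * (a * c - b * d - m')"
    by (simp_all add: algebra_simps)
  then have "3 dvd d" "3 dvd c - 1" by (metis dvd_triv_left)+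
  moreover have "\<bar>d\<bar> < 2"
  proof (rule ccontr)
    assume "\<not> \<bar>d\<bar> < 2"
    then have "2\<^sup>2 \<le> \<bar>d\<bar>\<^sup>2" by (intro power_mono) auto
    moreover have "(2 * c - d)\<^sup>2 \<ge> 0" by simp
    ultimately show False using norm by simp
  qed
  ultimately have "d = 0" by presburger
  moreover from this norm have "c\<^sup>2 = 1" by simp
  then have "c = 1 \<or> c = - 1" by (simp add: power2_eq_1_iff)
  ultimately have "\<gamma> = 1" using \<open>3 dvd c - 1\<close> cd by auto
  then show ?thesis by (simp add: \<gamma>)
qed

section \<open>The character of \<open>1 - \<omega>\<close>\<close>

text \<open>Comparing rational coordinates gives \<open>m = e - c\<close>, and the exponent
  \<open>c + 2 e\<close> is \<open>2 m + 3 c\<close>. As \<open>m\<close> may be negative, the power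
  is taken in the complex numbers.\<close>

lemma chi_one_minus_omega_power_int:
  assumes "\<pi> = of_int (3 * m - 1) + of_int b * eis_omega"
  shows "complex_of_eis (\<chi> (1 - eis_omega)) = complex_omega powi (2 * m)"
proof -
  define c e where "c = cyclotomic_number eis_omega eis_omega"
    and "e = cyclotomic_number eis_omega (eis_omega\<^sup>2)"
  have "m = int e - int c"
    using trans[OF assms[symmetric] trans[OF jacobi_sum_eq[symmetric] jacobi_sum_coords]]
    unfolding eisenstein_eq_iff c_def e_def by simp
  then have exp: "int (c + 2 * e) = 2 * m + int (3 * c)" by simp
  have power: "complex_of_eis (eis_omega ^ n) = complex_omega ^ n" for n
    by (induction n) (simp_all add: one_eisenstein.rep_eq times_eisenstein.rep_eq eis_omega.rep_eq)
  have cube: "complex_omega ^ 3 = 1"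
    unfolding power[symmetric] eis_omega_cube by (rule one_eisenstein.rep_eq)
  then have "complex_omega \<noteq> 0" by auto
  have "complex_of_eis (\<chi> (1 - eis_omega)) = complex_omega powi int (c + 2 * e)"
    unfolding chi_one_minus_omega power c_def e_def by (simp only: power_int_of_nat)
  also have "\<dots> = complex_omega powi (2 * m) * complex_omega ^ (3 * c)"
    unfolding exp power_int_of_nat[symmetric]
    using \<open>complex_omega \<noteq> 0\<close> by (intro power_int_add disjI1)
  also have "\<dots> = complex_omega powi (2 * m)"
    by (simp add: power_mult cube)
  finally show ?thesis .
qed

end

theorem theorem3p15:
  fixes \<pi> :: eisenstein
  assumes "prime_elem \<pi>" and "eis_primary \<pi>" and "eis_norm \<pi> \<noteq> 3"
  shows "(\<forall>q m :: int. prime_elem q \<and> \<pi> = of_int q \<and> q = 3 * m - 1 \<longrightarrow>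
            complex_of_eis (cubic_char \<pi> (1 - eis_omega)) = complex_omega powi (2 * m)) \<and>
         ((\<nexists>q :: int. prime_elem q \<and> \<pi> = of_int q) \<longrightarrow>
            (\<forall>a b m :: int. \<pi> = of_int a + of_int b * eis_omega \<and> a = 3 * m - 1 \<longrightarrow>
               complex_of_eis (cubic_char \<pi> (1 - eis_omega)) = complex_omega powi (2 * m)))"
proof -
  have "\<pi> \<noteq> 0" using assms(1) by auto
  then obtain R where R: "finite R" "int (card R) = eis_norm \<pi>" "\<And>z. \<exists>!x. x \<in> R \<and> \<pi> dvd z - x"
    using ex_eis_residue_system by metis
  obtain a b where ab: "\<pi> = of_int (3 * a - 1) + of_int (3 * b) * eis_omega"
    using assms(2) by (rule eis_primaryE)
  \<comment> \<open>A primary element has norm 1 modulo 3, which yields the \<open>k\<close> of the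
    locale.\<close>
  have "eis_norm \<pi> = 3 * (3 * a\<^sup>2 - 2 * a - 3 * a * b + b + 3 * b\<^sup>2) + 1"
    unfolding ab eis_norm_eq by (simp add: power2_eq_square algebra_simps)
  then have "int (card R) mod 3 = 1" unfolding R(2) by presburger
  then have "card R = 3 * (card R div 3) + 1" by presburger
  then interpret primary_eis_prime \<pi> R "card R div 3"
    using R assms by unfold_locales auto
  \<comment> \<open>A rational prime is the case \<open>b = 0\<close> of the same formula.\<close>
  show ?thesis
    using chi_one_minus_omega_power_int[where b = 0] chi_one_minus_omega_power_int by auto
qed

end
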